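(* Let $\Lambda \subset \mathbb{R}^n$ be a Lebesgue measurable set with finite Lebesgue measure, let $V \in L^1(\Lambda, \mathbb{R})$ be a function, and let $\{J_d\}_{d \in \mathbb{N}}$ be a family of functions $J_d \in L^1(\Lambda, \mathbb{R})$ satisfying the following properties: 1. For every $d \in \mathbb{N}$ we have $V(x) \le J_d(x)$ for all $x \in \Lambda$. 2. $\lim_{d \to \infty} \|V - J_d\|_{L^1(\Lambda, \mathbb{R})} = 0$. Then for all $\gamma \in \mathbb{R}$, $$\lim_{d \to \infty} D_V\big(\{x \in \Lambda : J_d(x) < \gamma\}, \{x \in \Lambda : V(x) < \gamma\}\big) = 0.$$
   Context: $\mu$ denotes Lebesgue measure on $\mathbb{R}^n$. For Lebesgue measurable sets $A, B \subset \mathbb{R}^n$, the volume metric is $D_V(A,B) := \mu\big((A \setminus B) \cup (B \setminus A)\big)$. Also $\|f\|_{L^1(\Lambda,\mathbb{R})} := \int_\Lambda |f(x)|\,dx$, and $f \in L^1(\Lambda,\mathbb{R})$ means $f : \Lambda \to \mathbb{R}$ with $\|f\|_{L^1(\Lambda,\mathbb{R})} < \infty$. *)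

theory Defs
  imports "HOL-Analysis.Analysis"
begin

text \<open>
  The volume metric takes values in the extended nonnegative reals, so that a symmetric
  difference of infinite measure is at distance \<open>\<infinity>\<close>; with the real-valued
  \<^const>\<open>measure\<close> it would be at distance \<open>0\<close>. It is meant for Lebesgue measurable
  arguments only.
\<close>
definition volume_dist :: "(real ^ 'n) set \<Rightarrow> (real ^ 'n) set \<Rightarrow> ennreal"
  where "volume_dist A B = emeasure lebesgue ((A - B) \<union> (B - A))"

text \<open>
  A function on \<open>\<Lambda>\<close> is given as a total function whose values outside \<open>\<Lambda>\<close> are irrelevant.
  Membership in \<open>L\<^sup>1(\<Lambda>)\<close> is \<^term>\<open>set_integrable lebesgue \<Lambda> f\<close>; for other functions
  the value of \<open>L1_norm\<close> has no meaning.
\<close>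
definition L1_norm :: "(real ^ 'n) set \<Rightarrow> (real ^ 'n \<Rightarrow> real) \<Rightarrow> real"
  where "L1_norm \<Lambda> f = (LINT x:\<Lambda>|lebesgue. \<bar>f x\<bar>)"

end

theory Submission
  imports Defs
begin

text \<open>
  Since \<open>V \<le> J d\<close>, the symmetric difference is \<open>{V < \<gamma> \<le> J d}\<close>. For each \<open>c > 0\<close> it is covered
  by the strip \<open>{\<gamma> - c < V < \<gamma>}\<close> and the set \<open>{J d - V \<ge> c}\<close>. As \<open>c\<close> tends to \<open>0\<close>, the strips
  decrease to the empty set within a set of finite measure, so that their measures tend to \<open>0\<close>;
  for fixed \<open>c\<close>, Markov's inequality bounds the measure of the second set by
  \<open>\<parallel>V - J d\<parallel>\<^sub>1 / c\<close>.
\<close>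

text \<open>The values of \<open>f\<close> outside \<open>A\<close> are arbitrary, so measurability
  is transferred through the extension by zero, which is measurable on the whole space and agrees
  with \<open>f\<close> on \<open>A\<close>.\<close>

lemma sets_Collect_set_borel_measurable:
  fixes f :: "'a \<Rightarrow> real"
  assumes f: "set_borel_measurable M A f" and [measurable]: "A \<in> sets M" "B \<in> sets borel"
  shows "{x \<in> A. f x \<in> B} \<in> sets M"
proof -
  have [measurable]: "(\<lambda>x. indicator A x *\<^sub>R f x) \<in> borel_measurable M"
    using f by (simp add: set_borel_measurable_def)
  have "{x \<in> A. f x \<in> B} = A \<inter> {x \<in> space M. indicator A x *\<^sub>R f x \<in> B}"
    using sets.sets_into_space[OF assms(2)] by auto
  also have "\<dots> \<in> sets M"
    by measurable
  finally show ?thesis .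
qed

text \<open>Continuity from above, starting from a set of finite measure. The strips exclude the
  level \<gamma> itself: this makes their intersection empty, whereas the level set
  \<open>f x = \<gamma>\<close> could have positive measure.\<close>

lemma tendsto_emeasure_strip_below:
  fixes f :: "'a \<Rightarrow> real"
  assumes f: "set_borel_measurable M A f" and A: "A \<in> sets M" "emeasure M A < \<infinity>"
  shows "(\<lambda>k. emeasure M {x \<in> A. f x \<in> {\<gamma> - inverse (real (Suc k))<..<\<gamma>}}) \<longlonglongrightarrow> 0"
proof -
  let ?S = "\<lambda>k. {x \<in> A. f x \<in> {\<gamma> - inverse (real (Suc k))<..<\<gamma>}}"
  have meas: "?S k \<in> sets M" for k
    using f A(1) by (rule sets_Collect_set_borel_measurable) simp
  have "decseq ?S"
  proof (intro decseq_SucI subsetI)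
    fix k x
    assume x: "x \<in> ?S (Suc k)"
    have "inverse (real (Suc (Suc k))) \<le> inverse (real (Suc k))"
      by (intro le_imp_inverse_le) auto
    with x show "x \<in> ?S k"
      unfolding mem_Collect_eq greaterThanLessThan_iff by linarith
  qed
  moreover have "emeasure M (?S k) \<noteq> \<infinity>" for k
  proof -
    have "emeasure M (?S k) \<le> emeasure M A"
      by (rule emeasure_mono) (use A in auto)
    then show ?thesis
      using A(2) by (metis infinity_ennreal_def leD)
  qed
  ultimately have "(\<lambda>k. emeasure M (?S k)) \<longlonglongrightarrow> emeasure M (\<Inter>k. ?S k)"
    using meas by (intro Lim_emeasure_decseq) auto
  moreover have "(\<Inter>k. ?S k) = {}"
  proof (rule equals0I)
    fix x
    assume x: "x \<in> (\<Inter>k. ?S k)"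
    then have "f x < \<gamma>"
      by auto
    then obtain k where "inverse (real (Suc k)) < \<gamma> - f x"
      using reals_Archimedean[of "\<gamma> - f x"] by auto
    moreover have "\<gamma> - inverse (real (Suc k)) < f x"
      using x by auto
    ultimately show False
      by linarith
  qed
  ultimately show ?thesis
    by simp
qed

lemma tendsto_emeasure_strict_sublevel_diff:
  fixes f :: "'a \<Rightarrow> real" and g :: "nat \<Rightarrow> 'a \<Rightarrow> real"
  assumes A: "A \<in> sets M" "emeasure M A < \<infinity>"
    and f: "set_integrable M A f" and g: "\<And>d. set_integrable M A (g d)"
    and lim: "(\<lambda>d. LINT x:A|M. \<bar>f x - g d x\<bar>) \<longlonglongrightarrow> 0"
  shows "(\<lambda>d. emeasure M {x \<in> A. f x < \<gamma> \<and> \<gamma> \<le> g d x}) \<longlonglongrightarrow> 0"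
proof (rule order_tendstoI)
  fix a :: ennreal
  assume "a < 0"
  then show "\<forall>\<^sub>F d in sequentially. a < emeasure M {x \<in> A. f x < \<gamma> \<and> \<gamma> \<le> g d x}"
    by (simp only: not_less_zero)
next
  fix a :: ennreal
  assume "0 < a"
  \<comment> \<open>Since \<open>a\<close> may be infinite, a real \<open>b\<close> below it is
    extracted; each of the two covering sets is then allotted \<open>b / 2\<close>.\<close>
  then obtain y where y: "0 < y" "y < a"
    using dense by blast
  then obtain b :: real where b: "0 < b" "ennreal b < a"
    by (cases y) auto
  have fm: "set_borel_measurable M A f"
    using f by (auto simp: set_integrable_def set_borel_measurable_def)
  let ?S = "\<lambda>k. {x \<in> A. f x \<in> {\<gamma> - inverse (real (Suc k))<..<\<gamma>}}"
  \<comment> \<open>The strip does not involve \<open>g\<close>, so its width \<open>c\<close> can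
    be fixed before \<open>d\<close> varies; the factor \<open>1 / c\<close> in the Markov bound is
    then a constant.\<close>
  have "\<forall>\<^sub>F k in sequentially. emeasure M (?S k) < ennreal (b / 2)"
    using tendsto_emeasure_strip_below[OF fm A] by (rule order_tendstoD) (use b in simp)
  then obtain k where k: "emeasure M (?S k) < ennreal (b / 2)"
    by (auto simp: eventually_sequentially)
  define c where "c = inverse (real (Suc k))"
  have "0 < c"
    by (simp add: c_def)
  let ?D = "\<lambda>d. {x \<in> A. c \<le> \<bar>f x - g d x\<bar>}"
  have int: "set_integrable M A (\<lambda>x. \<bar>f x - g d x\<bar>)" for d
    using f g by (intro set_integrable_abs set_integral_diff)
  have markov: "emeasure M (?D d) \<le> ennreal (1 / c * (LINT x:A|M. \<bar>f x - g d x\<bar>))" for d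
    using int A(1) \<open>0 < c\<close> by (intro integral_Markov_inequality') auto
  have "(\<lambda>d. 1 / c * (LINT x:A|M. \<bar>f x - g d x\<bar>)) \<longlonglongrightarrow> 0"
    using tendsto_mult_left[OF lim, of "1 / c"] by simp
  then have "\<forall>\<^sub>F d in sequentially. 1 / c * (LINT x:A|M. \<bar>f x - g d x\<bar>) < b / 2"
    by (rule order_tendstoD) (use b in simp)
  then show "\<forall>\<^sub>F d in sequentially. emeasure M {x \<in> A. f x < \<gamma> \<and> \<gamma> \<le> g d x} < a"
  proof eventually_elim
    case (elim d)
    have S: "?S k \<in> sets M"
      using fm A(1) by (rule sets_Collect_set_borel_measurable) simp
    have "set_borel_measurable M A (\<lambda>x. \<bar>f x - g d x\<bar>)"
      using int[of d] by (auto simp: set_integrable_def set_borel_measurable_def)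
    then have "{x \<in> A. \<bar>f x - g d x\<bar> \<in> {c..}} \<in> sets M"
      using A(1) by (rule sets_Collect_set_borel_measurable) simp
    then have D: "?D d \<in> sets M"
      by simp
    \<comment> \<open>A point outside the strip has \<open>f x \<le> \<gamma> - c\<close>, and with
      \<open>\<gamma> \<le> g d x\<close> the gap is at least \<open>c\<close>.\<close>
    have "emeasure M {x \<in> A. f x < \<gamma> \<and> \<gamma> \<le> g d x} \<le> emeasure M (?S k \<union> ?D d)"
      using S D by (intro emeasure_mono) (auto simp: c_def)
    also have "\<dots> \<le> emeasure M (?S k) + emeasure M (?D d)"
      using S D by (rule emeasure_subadditive)
    also have "\<dots> \<le> ennreal (b / 2) + ennreal (b / 2)"
      using less_imp_le[OF k] order_trans[OF markov ennreal_leI[OF less_imp_le[OF elim]]]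
      by (rule add_mono)
    also have "\<dots> = ennreal b"
      using b by (subst ennreal_plus[symmetric]) auto
    finally show ?case
      using b(2) by simp
  qed
qed

theorem theorem2:
  fixes \<Lambda> :: "(real ^ 'n) set"
    and V :: "real ^ 'n \<Rightarrow> real"
    and J :: "nat \<Rightarrow> real ^ 'n \<Rightarrow> real"
  assumes "\<Lambda> \<in> sets lebesgue"
    and "emeasure lebesgue \<Lambda> < \<infinity>"
    and "set_integrable lebesgue \<Lambda> V"
    and "\<And>d. set_integrable lebesgue \<Lambda> (J d)"
    and "\<And>d x. x \<in> \<Lambda> \<Longrightarrow> V x \<le> J d x"
    and "(\<lambda>d. L1_norm \<Lambda> (\<lambda>x. V x - J d x)) \<longlonglongrightarrow> 0"
  shows "\<forall>\<gamma>::real. (\<lambda>d. volume_dist {x \<in> \<Lambda>. J d x < \<gamma>} {x \<in> \<Lambda>. V x < \<gamma>}) \<longlonglongrightarrow> 0"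
proof
  fix \<gamma> :: real
  have "({x \<in> \<Lambda>. J d x < \<gamma>} - {x \<in> \<Lambda>. V x < \<gamma>}) \<union> ({x \<in> \<Lambda>. V x < \<gamma>} - {x \<in> \<Lambda>. J d x < \<gamma>})
      = {x \<in> \<Lambda>. V x < \<gamma> \<and> \<gamma> \<le> J d x}" for d
    \<comment> \<open>The first difference is empty: \<open>J d x < \<gamma>\<close> forces
      \<open>V x < \<gamma>\<close>.\<close>
    using order.strict_trans1[OF assms(5)] by (fastforce simp: not_less)
  then have "volume_dist {x \<in> \<Lambda>. J d x < \<gamma>} {x \<in> \<Lambda>. V x < \<gamma>}
      = emeasure lebesgue {x \<in> \<Lambda>. V x < \<gamma> \<and> \<gamma> \<le> J d x}" for d
    by (simp only: volume_dist_def)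
  then show "(\<lambda>d. volume_dist {x \<in> \<Lambda>. J d x < \<gamma>} {x \<in> \<Lambda>. V x < \<gamma>}) \<longlonglongrightarrow> 0"
    using tendsto_emeasure_strict_sublevel_diff[OF assms(1-4) assms(6)[unfolded L1_norm_def]]
    by (simp only:)
qed

end
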